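(* Limaçons of Pascal are rational. That is: let $\mathbb K$ be an algebraically closed field of characteristic zero, let $(c_1,c_2)\in\mathbb K^2$, $r\in\mathbb K\setminus\{0\}$, let $\mathcal C\subset\mathbb K^2$ be the circle $(y_1-c_1)^2+(y_2-c_2)^2=r^2$, let $A\in\mathcal C$ and $d\in\mathbb K\setminus\{0\}$. Then the conchoid of $\mathcal C$ from the focus $A$ and distance $d$ is rational.
   Context: A limaçon of Pascal is the conchoid of a circle from a focus lying on the circle. For $P=(P_1,P_2)$ write $\|P\|^2=P_1^2+P_2^2$ (no conjugation). The conchoid of $\mathcal C$ from the focus $A$ and distance $d$ is the Zariski closure in $\mathbb K^2$ of the set of points $\bar x\in\mathbb K^2$ for which there exist $\bar y\in\mathcal C$ and $\lambda\in\mathbb K$ with $\|\bar x-\bar y\|^2=d^2$ and $\bar x=A+\lambda(\bar y-A)$. A plane curve is rational if it is irreducible and there is a pair of rational functions in $\mathbb K(t)^2$, not both constant, whose values are Zariski dense in the curve. *)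

theory Defs
  imports "HOL-Computational_Algebra.Polynomial" "HOL-Computational_Algebra.Fraction_Field"
    "HOL-Library.Product_Plus"
begin

text \<open>
  The polynomial ring \<open>K[X, Y]\<close> is represented as \<open>K[X][Y]\<close>: the outer variable is the second
  coordinate, and the coefficients are polynomials in the first coordinate.
\<close>

definition poly2 :: "'k::comm_ring_1 poly poly \<Rightarrow> 'k \<times> 'k \<Rightarrow> 'k" where
  "poly2 f P = poly (poly f [:snd P:]) (fst P)"

definition zariski_closed :: "('k::comm_ring_1 \<times> 'k) set \<Rightarrow> bool" where
  "zariski_closed X \<longleftrightarrow> (\<exists>F. X = {P. \<forall>f\<in>F. poly2 f P = 0})"

definition zariski_closure :: "('k::comm_ring_1 \<times> 'k) set \<Rightarrow> ('k \<times> 'k) set" where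
  "zariski_closure S = \<Inter> {X. zariski_closed X \<and> S \<subseteq> X}"

definition plane_curve :: "('k::comm_ring_1 \<times> 'k) set \<Rightarrow> bool" where
  "plane_curve X \<longleftrightarrow> (\<exists>f. (\<forall>c. f \<noteq> [:[:c:]:]) \<and> X = {P. poly2 f P = 0})"

definition zariski_irreducible :: "('k::comm_ring_1 \<times> 'k) set \<Rightarrow> bool" where
  "zariski_irreducible X \<longleftrightarrow> X \<noteq> {} \<and>
     (\<forall>Y Z. zariski_closed Y \<and> zariski_closed Z \<and> X = Y \<union> Z \<longrightarrow> X = Y \<or> X = Z)"

text \<open>
  Elements of \<open>'k poly fract\<close> are the rational functions in one variable. Being a partial function,
  evaluation is a relation: \<open>ratfun_value \<phi> t v\<close> says that \<open>\<phi>\<close> has no pole at \<open>t\<close> and takes the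
  value \<open>v\<close> there.
\<close>

definition ratfun_value :: "'k::field poly fract \<Rightarrow> 'k \<Rightarrow> 'k \<Rightarrow> bool" where
  "ratfun_value \<phi> t v \<longleftrightarrow>
     (\<exists>p q. \<phi> = Fract p q \<and> poly q t \<noteq> 0 \<and> v = poly p t / poly q t)"

definition ratfun_constant :: "'k::field poly fract \<Rightarrow> bool" where
  "ratfun_constant \<phi> \<longleftrightarrow> (\<exists>c. \<phi> = Fract [:c:] 1)"

definition ratfun_pair_values :: "'k::field poly fract \<Rightarrow> 'k poly fract \<Rightarrow> ('k \<times> 'k) set" where
  "ratfun_pair_values \<phi> \<psi> = {(u, v). \<exists>t. ratfun_value \<phi> t u \<and> ratfun_value \<psi> t v}"

definition rational_plane_curve :: "('k::field \<times> 'k) set \<Rightarrow> bool" where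
  "rational_plane_curve X \<longleftrightarrow> plane_curve X \<and> zariski_irreducible X \<and>
     (\<exists>\<phi> \<psi>. \<not> (ratfun_constant \<phi> \<and> ratfun_constant \<psi>) \<and>
            ratfun_pair_values \<phi> \<psi> \<subseteq> X \<and> X \<subseteq> zariski_closure (ratfun_pair_values \<phi> \<psi>))"

definition normsq :: "'k::comm_ring_1 \<times> 'k \<Rightarrow> 'k" where
  "normsq P = (fst P)\<^sup>2 + (snd P)\<^sup>2"

definition circle :: "'k::comm_ring_1 \<times> 'k \<Rightarrow> 'k \<Rightarrow> ('k \<times> 'k) set" where
  "circle c r = {y. (fst y - fst c)\<^sup>2 + (snd y - snd c)\<^sup>2 = r\<^sup>2}"

definition conchoid ::
    "('k::comm_ring_1 \<times> 'k) set \<Rightarrow> 'k \<times> 'k \<Rightarrow> 'k \<Rightarrow> ('k \<times> 'k) set" where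
  "conchoid C A d = zariski_closure
     {x. \<exists>y\<in>C. \<exists>l. normsq (x - y) = d\<^sup>2 \<and> x = A + (l * fst (y - A), l * snd (y - A))}"

end

theory Submission
  imports Defs
begin

text \<open>
  Put \<open>m = c - A\<close>, so that \<open>m \<cdot> m = r\<^sup>2\<close>. Writing \<open>x\<close> for the vector from the focus \<open>A\<close> to a point,
  the circle is \<open>x \<cdot> x = 2 (m \<cdot> x)\<close>. Hence the line through \<open>A\<close> with unit direction \<open>u\<close> meets the
  circle again in \<open>2 (m \<cdot> u) u\<close>, and stepping by \<open>d\<close> along that line gives the conchoid point
  \<open>(2 (m \<cdot> u) + d) u\<close>; stepping the other way gives the point that belongs to \<open>-u\<close>, so one formula
  covers both. The unit directions have the rational parametrization \<open>u\<^sub>1 + i u\<^sub>2 = t\<close>,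
  \<open>u\<^sub>1 - i u\<^sub>2 = 1 / t\<close> with \<open>i\<^sup>2 = -1\<close>, and therefore the conchoid points are parametrized by rational
  functions of \<open>t\<close> with denominator \<open>2 t\<^sup>2\<close>.

  The image of this parametrization is exactly the quartic
  \<open>(x \<cdot> x - 2 (m \<cdot> x))\<^sup>2 = d\<^sup>2 (x \<cdot> x)\<close> (lemma \<open>limacon_eq_image\<close>), so it is already Zariski closed
  and a plane curve. The defining set of the conchoid lies on the quartic, and of the points of
  the parametrization it can miss only the finitely many with \<open>m \<cdot> u = 0\<close>, where the line is tangent
  to the circle at \<open>A\<close>. Since a polynomial that vanishes at infinitely many parameters vanishes at
  all of them (lemma \<open>zariski_closed_contains_param_curve\<close>), the conchoid is the whole quartic. The
  same principle makes the quartic irreducible.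
\<close>

section \<open>Rationally parametrized sets\<close>

lemma poly2_simps [simp]:
  "poly2 (f + g) P = poly2 f P + poly2 g P"
  "poly2 (f - g) P = poly2 f P - poly2 g P"
  "poly2 (f * g) P = poly2 f P * poly2 g P"
  "poly2 (f ^ n) P = poly2 f P ^ n"
  "poly2 [:a:] P = poly a (fst P)"
  by (simp_all add: poly2_def poly_power)

lemma poly2_pCons: "poly2 (pCons a f) P = poly a (fst P) + snd P * poly2 f P"
  by (simp add: poly2_def)

definition param_point :: "'k::field poly \<Rightarrow> 'k poly \<Rightarrow> 'k poly \<Rightarrow> 'k \<Rightarrow> 'k \<times> 'k" where
  "param_point p1 p2 q t = (poly p1 t / poly q t, poly p2 t / poly q t)"

definition param_curve :: "'k::field poly \<Rightarrow> 'k poly \<Rightarrow> 'k poly \<Rightarrow> ('k \<times> 'k) set" where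
  "param_curve p1 p2 q = param_point p1 p2 q ` {t. poly q t \<noteq> 0}"

lemma pullback_one_variable:
  fixes a p q :: "'k::field poly"
  shows "\<exists>g N. \<forall>t. poly q t \<noteq> 0 \<longrightarrow> poly a (poly p t / poly q t) * poly q t ^ N = poly g t"
proof (induction a)
  case 0
  show ?case by (rule exI[of _ 0]) simp
next
  case (pCons a f)
  then obtain g N where
    g: "\<And>t. poly q t \<noteq> 0 \<Longrightarrow> poly f (poly p t / poly q t) * poly q t ^ N = poly g t"
    by blast
  show ?case
  proof (intro exI allI impI)
    fix t assume t: "poly q t \<noteq> 0"
    have "poly (pCons a f) (poly p t / poly q t) * poly q t ^ Suc N =
        a * poly q t ^ Suc N + poly p t * (poly f (poly p t / poly q t) * poly q t ^ N)"
      using t by (simp add: field_simps)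
    also have "\<dots> = poly (smult a (q ^ Suc N) + p * g) t"
      using g[OF t] by (simp add: poly_power)
    finally show "poly (pCons a f) (poly p t / poly q t) * poly q t ^ Suc N =
        poly (smult a (q ^ Suc N) + p * g) t" .
  qed
qed

text \<open>
  Clearing denominators: along a rational parametrization a polynomial in two variables becomes a
  polynomial in the parameter, up to a power of the denominator.
\<close>

lemma pullback_two_variables:
  fixes f :: "'k::field poly poly"
  shows "\<exists>g N. \<forall>t. poly q t \<noteq> 0 \<longrightarrow> poly2 f (param_point p1 p2 q t) * poly q t ^ N = poly g t"
proof (induction f)
  case 0
  show ?case by (rule exI[of _ 0]) (simp add: poly2_def)
next
  case (pCons a f)
  then obtain g N where
    g: "\<And>t. poly q t \<noteq> 0 \<Longrightarrow> poly2 f (param_point p1 p2 q t) * poly q t ^ N = poly g t"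
    by blast
  obtain h M where
    h: "\<And>t. poly q t \<noteq> 0 \<Longrightarrow> poly a (poly p1 t / poly q t) * poly q t ^ M = poly h t"
    using pullback_one_variable[of q a p1] by blast
  show ?case
  proof (intro exI allI impI)
    fix t assume t: "poly q t \<noteq> 0"
    let ?P = "param_point p1 p2 q t"
    have "poly2 (pCons a f) ?P * poly q t ^ (Suc N + M) =
        (poly a (poly p1 t / poly q t) * poly q t ^ M) * poly q t ^ Suc N +
        poly p2 t * poly q t ^ M * (poly2 f ?P * poly q t ^ N)"
      using t by (simp add: poly2_pCons param_point_def field_simps power_add)
    also have "\<dots> = poly (h * q ^ Suc N + p2 * q ^ M * g) t"
      using g[OF t] h[OF t] by (simp add: poly_power)
    finally show "poly2 (pCons a f) ?P * poly q t ^ (Suc N + M) =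
        poly (h * q ^ Suc N + p2 * q ^ M * g) t" .
  qed
qed

text \<open>
  The pullback of a polynomial that vanishes on \<open>Y\<close> has infinitely many roots, hence is zero.
\<close>

lemma zariski_closed_contains_param_curve:
  fixes Y :: "('k::field \<times> 'k) set"
  assumes "zariski_closed Y"
    and inf: "infinite {t. poly q t \<noteq> 0 \<and> param_point p1 p2 q t \<in> Y}"
  shows "param_curve p1 p2 q \<subseteq> Y"
proof -
  obtain F where Y: "Y = {P. \<forall>f\<in>F. poly2 f P = 0}"
    using assms(1) unfolding zariski_closed_def by blast
  have "poly2 f (param_point p1 p2 q t) = 0" if f: "f \<in> F" and t: "poly q t \<noteq> 0" for f t
  proof -
    obtain g N where
      g: "\<And>t. poly q t \<noteq> 0 \<Longrightarrow> poly2 f (param_point p1 p2 q t) * poly q t ^ N = poly g t"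
      using pullback_two_variables[of q f p1 p2] by blast
    have "{t. poly q t \<noteq> 0 \<and> param_point p1 p2 q t \<in> Y} \<subseteq> {t. poly g t = 0}"
      using f Y g by force
    then have "g = 0"
      using inf poly_roots_finite finite_subset by blast
    then show ?thesis using g[OF t] t by simp
  qed
  then show ?thesis unfolding param_curve_def Y by blast
qed

lemma infinite_nonroots:
  fixes q :: "'k::field_char_0 poly"
  assumes "q \<noteq> 0"
  shows "infinite {t. poly q t \<noteq> 0}"
proof
  assume "finite {t. poly q t \<noteq> 0}"
  then have "finite ({t. poly q t \<noteq> 0} \<union> {t. poly q t = 0})"
    using poly_roots_finite[OF assms] by (rule finite_UnI)
  moreover have "{t. poly q t \<noteq> 0} \<union> {t. poly q t = 0} = UNIV" by auto
  ultimately show False using infinite_UNIV_char_0[where 'a = 'k] by simp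
qed

text \<open>
  If two closed sets cover the curve, one of them receives infinitely many parameters and therefore
  contains the whole curve.
\<close>

lemma zariski_irreducible_param_curve:
  fixes q :: "'k::field_char_0 poly"
  assumes "q \<noteq> 0"
  shows "zariski_irreducible (param_curve p1 p2 q)"
  unfolding zariski_irreducible_def
proof (intro conjI allI impI)
  have "{t. poly q t \<noteq> 0} \<noteq> {}" using infinite_nonroots[OF assms] by force
  then show "param_curve p1 p2 q \<noteq> {}" unfolding param_curve_def by simp
next
  fix Y Z assume YZ: "zariski_closed Y \<and> zariski_closed Z \<and> param_curve p1 p2 q = Y \<union> Z"
  let ?T = "\<lambda>W. {t. poly q t \<noteq> 0 \<and> param_point p1 p2 q t \<in> W}"
  have eq: "{t. poly q t \<noteq> 0} = ?T Y \<union> ?T Z"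
  proof -
    have "param_point p1 p2 q t \<in> Y \<union> Z" if "poly q t \<noteq> 0" for t
      using that YZ[THEN conjunct2, THEN conjunct2, symmetric] by (simp add: param_curve_def)
    then show ?thesis by auto
  qed
  have "infinite (?T Y) \<or> infinite (?T Z)"
    using infinite_nonroots[OF assms] unfolding eq finite_Un de_Morgan_conj .
  then have "param_curve p1 p2 q \<subseteq> Y \<or> param_curve p1 p2 q \<subseteq> Z"
    using zariski_closed_contains_param_curve[of Y q p1 p2]
      zariski_closed_contains_param_curve[of Z q p1 p2] YZ by argo
  then show "param_curve p1 p2 q = Y \<or> param_curve p1 p2 q = Z"
    using YZ by auto
qed

text \<open>
  A fraction may take a value at a zero of its denominator when another representation of it has
  none there. Without common zeros of numerator and denominator this cannot happen, and every value
  can be computed from the given representation.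
\<close>

lemma ratfun_value_Fract_iff:
  fixes p q :: "'k::field poly"
  assumes "q \<noteq> 0" and nc: "\<And>s. poly q s = 0 \<Longrightarrow> poly p s \<noteq> 0"
  shows "ratfun_value (Fract p q) t v \<longleftrightarrow> poly q t \<noteq> 0 \<and> v = poly p t / poly q t"
proof
  assume "ratfun_value (Fract p q) t v"
  then obtain p' q' where 1: "Fract p q = Fract p' q'" "poly q' t \<noteq> 0" "v = poly p' t / poly q' t"
    unfolding ratfun_value_def by blast
  then have "q' \<noteq> 0" by auto
  then have "p * q' = p' * q" using 1(1) assms(1) by (simp add: eq_fract)
  then have *: "poly p t * poly q' t = poly p' t * poly q t" by (metis poly_mult)
  then have "poly q t \<noteq> 0" using nc 1(2) by fastforce
  then show "poly q t \<noteq> 0 \<and> v = poly p t / poly q t"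
    using * 1 by (simp add: frac_eq_eq)
qed (auto simp: ratfun_value_def)

text \<open>
  The absence of common zeros makes the values of the pair of fractions exactly the points of the
  curve, and the pole at \<open>a\<close> keeps the pair from being constant.
\<close>

lemma rational_plane_curve_param_curve:
  fixes q :: "'k::field_char_0 poly"
  assumes q: "q \<noteq> 0" "poly q a = 0"
    and nc: "\<And>s. poly q s = 0 \<Longrightarrow> poly p1 s \<noteq> 0" "\<And>s. poly q s = 0 \<Longrightarrow> poly p2 s \<noteq> 0"
    and "plane_curve (param_curve p1 p2 q)"
  shows "rational_plane_curve (param_curve p1 p2 q)"
proof -
  have vals: "ratfun_pair_values (Fract p1 q) (Fract p2 q) = param_curve p1 p2 q"
    by (auto simp: ratfun_pair_values_def param_curve_def param_point_def
        ratfun_value_Fract_iff[OF q(1) nc(1)] ratfun_value_Fract_iff[OF q(1) nc(2)])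
  have "\<not> ratfun_constant (Fract p1 q)"
  proof
    assume "ratfun_constant (Fract p1 q)"
    then obtain k where "Fract p1 q = Fract [:k:] 1"
      unfolding ratfun_constant_def by blast
    then have "p1 = [:k:] * q" using q(1) by (simp add: eq_fract)
    then show False using q(2) nc(1)[of a] by simp
  qed
  then have "\<not> (ratfun_constant (Fract p1 q) \<and> ratfun_constant (Fract p2 q))" by simp
  moreover have "param_curve p1 p2 q \<subseteq> zariski_closure (param_curve p1 p2 q)"
    unfolding zariski_closure_def by (rule Inter_greatest) simp
  ultimately show ?thesis
    unfolding rational_plane_curve_def
    using assms(5) zariski_irreducible_param_curve[OF q(1), of p1 p2] equalityD1[OF vals] vals
    by metis
qed

section \<open>The quartic of a limacon\<close>

text \<open>
  Here \<open>A\<close> is the focus, and \<open>m\<close> is the vector from \<open>A\<close> to the centre of the circle.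
\<close>

definition limacon :: "'k::field \<times> 'k \<Rightarrow> 'k \<times> 'k \<Rightarrow> 'k \<Rightarrow> ('k \<times> 'k) set" where
  "limacon A m d = {P. let x = P - A in
     (normsq x - 2 * (fst m * fst x + snd m * snd x))\<^sup>2 = d\<^sup>2 * normsq x}"

text \<open>
  In the isotropic coordinates \<open>x\<^sub>1 + i x\<^sub>2\<close> and \<open>x\<^sub>1 - i x\<^sub>2\<close> the quadratic form \<open>normsq\<close> is a product.
\<close>

lemma normsq_factor:
  fixes x :: "'k::comm_ring_1 \<times> 'k"
  assumes "i * i = - 1"
  shows "(fst x + i * snd x) * (fst x - i * snd x) = normsq x"
proof -
  have "(fst x + i * snd x) * (fst x - i * snd x) = fst x * fst x - (i * i) * (snd x * snd x)"
    by (simp add: algebra_simps)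
  then show ?thesis using assms by (simp add: normsq_def power2_eq_square)
qed

lemma isotropic_coordinates_nonzero:
  fixes x :: "'k::comm_ring_1 \<times> 'k"
  assumes "i * i = - 1" "normsq x \<noteq> 0"
  shows "fst x + i * snd x \<noteq> 0" "fst x - i * snd x \<noteq> 0"
  using normsq_factor[OF assms(1), of x] assms(2) by auto

text \<open>
  A nonconstant equation: on the isotropic line through the focus with direction \<open>(1, i)\<close>, where
  \<open>normsq\<close> vanishes, it reduces to the square of a nonzero linear form.
\<close>

lemma plane_curve_limacon:
  fixes A m :: "'k::field_char_0 \<times> 'k"
  assumes i: "i * i = (- 1 :: 'k)" and m: "normsq m \<noteq> 0"
  shows "plane_curve (limacon A m d)"
  unfolding plane_curve_def
proof (intro exI conjI allI)
  let ?x = "[:[:- fst A, 1:]:]" and ?y = "[:[:- snd A:], 1:]"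
  let ?n = "?x\<^sup>2 + ?y\<^sup>2"
  let ?f = "(?n - ([:[:2 * fst m:]:] * ?x + [:[:2 * snd m:]:] * ?y))\<^sup>2 - [:[:d\<^sup>2:]:] * ?n"
  have f: "poly2 ?f P =
      (normsq (P - A) - 2 * (fst m * fst (P - A) + snd m * snd (P - A)))\<^sup>2 - d\<^sup>2 * normsq (P - A)" for P
  proof -
    have x: "poly2 ?x P = fst (P - A)" and y: "poly2 ?y P = snd (P - A)"
      by (simp_all add: poly2_def)
    have const: "poly2 [:[:a:]:] P = a" for a by simp
    show ?thesis
      unfolding poly2_simps(1-4) x y const normsq_def
      by (simp only: distrib_left mult.assoc)
  qed
  show "limacon A m d = {P. poly2 ?f P = 0}"
    unfolding f limacon_def by (simp add: Let_def)
  fix k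
  show "?f \<noteq> [:[:k:]:]"
  proof
    assume eq: "?f = [:[:k:]:]"
    have const: "poly2 ?f P = k" for P unfolding eq by simp
    have "k = 0" using const[of A] unfolding f by (simp add: normsq_def)
    moreover have "poly2 ?f (A + (1, i)) = (2 * (fst m + i * snd m))\<^sup>2"
    proof -
      have "normsq (1, i) = 0" using i by (simp add: normsq_def power2_eq_square)
      then show ?thesis unfolding f add_diff_cancel_left'
        by (simp add: power2_eq_square algebra_simps)
    qed
    ultimately have "(2 * (fst m + i * snd m))\<^sup>2 = 0" using const[of "A + (1, i)"] by (simp only:)
    then show False
      using isotropic_coordinates_nonzero(1)[OF i m] unfolding power_eq_0_iff mult_eq_0_iff by simp
  qed
qed

section \<open>The parametrization of a limacon\<close>

text \<open>
  The unit vector \<open>u\<close> with \<open>u\<^sub>1 + i u\<^sub>2 = t\<close> and \<open>u\<^sub>1 - i u\<^sub>2 = 1 / t\<close>.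
\<close>

definition unit_vec :: "'k::field \<Rightarrow> 'k \<Rightarrow> 'k \<times> 'k" where
  "unit_vec i t = ((t + 1 / t) / 2, - i * (t - 1 / t) / 2)"

lemma normsq_unit_vec:
  assumes "i * i = (- 1 :: 'k::field_char_0)" "t \<noteq> 0"
  shows "normsq (unit_vec i t) = 1"
proof -
  have "i\<^sup>2 = - 1" using assms by (simp add: power2_eq_square)
  then have "normsq (unit_vec i t) = ((t + 1 / t)\<^sup>2 - (t - 1 / t)\<^sup>2) / 4"
    by (simp add: normsq_def unit_vec_def power_mult_distrib power_divide diff_divide_distrib)
  also have "\<dots> = 1" using assms by (simp add: power2_eq_square field_simps)
  finally show ?thesis .
qed

lemma unit_vec_surj:
  assumes i: "i * i = (- 1 :: 'k::field_char_0)" and u: "normsq u = 1"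
  obtains t where "t \<noteq> 0" "unit_vec i t = u"
proof -
  let ?t = "fst u + i * snd u"
  have *: "?t * (fst u - i * snd u) = 1" using normsq_factor[OF i, of u] u by simp
  then have t: "?t \<noteq> 0" by auto
  then have inv: "1 / ?t = fst u - i * snd u" using * by (simp add: divide_eq_eq mult.commute)
  have "- i * (2 * i * snd u) / 2 = snd u" using i
    by (simp add: mult.assoc[symmetric])
  then have "unit_vec i ?t = u"
    unfolding unit_vec_def inv by (simp add: prod_eq_iff algebra_simps)
  then show thesis using that t by blast
qed

text \<open>
  The numerators of \<open>A + (2 (m \<cdot> u) + d) u\<close> over the denominator \<open>2 t\<^sup>2\<close>, where \<open>u = unit_vec i t\<close>.
  The factor \<open>limacon_radius\<close> is \<open>t (2 (m \<cdot> u) + d)\<close>.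
\<close>

definition limacon_den :: "'k::field poly" where
  "limacon_den = [:0, 0, 2:]"

definition limacon_radius :: "'k::field \<Rightarrow> 'k \<times> 'k \<Rightarrow> 'k \<Rightarrow> 'k poly" where
  "limacon_radius i m d = [:fst m + i * snd m, d, fst m - i * snd m:]"

definition limacon_num1 :: "'k::field \<Rightarrow> 'k \<times> 'k \<Rightarrow> 'k \<times> 'k \<Rightarrow> 'k \<Rightarrow> 'k poly" where
  "limacon_num1 i A m d = smult (fst A) limacon_den + limacon_radius i m d * [:1, 0, 1:]"

definition limacon_num2 :: "'k::field \<Rightarrow> 'k \<times> 'k \<Rightarrow> 'k \<times> 'k \<Rightarrow> 'k \<Rightarrow> 'k poly" where
  "limacon_num2 i A m d =
     smult (snd A) limacon_den + smult (- i) (limacon_radius i m d * [:- 1, 0, 1:])"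

definition limacon_point :: "'k::field \<Rightarrow> 'k \<times> 'k \<Rightarrow> 'k \<times> 'k \<Rightarrow> 'k \<Rightarrow> 'k \<Rightarrow> 'k \<times> 'k" where
  "limacon_point i A m d =
     param_point (limacon_num1 i A m d) (limacon_num2 i A m d) limacon_den"

definition limacon_image :: "'k::field \<Rightarrow> 'k \<times> 'k \<Rightarrow> 'k \<times> 'k \<Rightarrow> 'k \<Rightarrow> ('k \<times> 'k) set" where
  "limacon_image i A m d =
     param_curve (limacon_num1 i A m d) (limacon_num2 i A m d) limacon_den"

lemma poly_limacon_den_eq_0_iff [simp]:
  "poly limacon_den (t :: 'k::field_char_0) = 0 \<longleftrightarrow> t = 0"
  by (simp add: limacon_den_def)

lemma limacon_image_eq:
  "limacon_image i A m d = limacon_point i A m d ` {t :: 'k::field_char_0. t \<noteq> 0}"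
  by (simp add: limacon_image_def limacon_point_def param_curve_def)

lemma poly_limacon_radius:
  assumes "i * i = (- 1 :: 'k::field_char_0)" "t \<noteq> 0" "u = unit_vec i t"
  shows "poly (limacon_radius i m d) t = t * (2 * (fst m * fst u + snd m * snd u) + d)"
proof -
  have eq: "2 * (fst m * fst u + snd m * snd u) = fst m * (t + 1 / t) - i * snd m * (t - 1 / t)"
    unfolding assms(3) unit_vec_def by (simp add: distrib_left)
  show ?thesis
    unfolding eq using assms(2) by (simp add: limacon_radius_def field_simps)
qed

lemma limacon_point_eq:
  assumes "i * i = (- 1 :: 'k::field_char_0)" "t \<noteq> 0" "u = unit_vec i t"
    and "s = 2 * (fst m * fst u + snd m * snd u) + d"
  shows "limacon_point i A m d t = A + (s * fst u, s * snd u)"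
proof -
  have r: "poly (limacon_radius i m d) t = t * s"
    using poly_limacon_radius[OF assms(1-3)] assms(4) by simp
  have 1: "poly (limacon_num1 i A m d) t = fst A * (2 * t * t) + t * s * (1 + t * t)"
    by (simp add: limacon_num1_def r limacon_den_def algebra_simps)
  have 2: "poly (limacon_num2 i A m d) t = snd A * (2 * t * t) - i * (t * s * (t * t - 1))"
    by (simp add: limacon_num2_def r limacon_den_def algebra_simps)
  show ?thesis
    unfolding limacon_point_def param_point_def 1 2 assms(3) unit_vec_def
    using assms(2) by (simp add: limacon_den_def prod_eq_iff) (simp add: field_simps)
qed

text \<open>
  Every point of the quartic is \<open>x = s u\<close> with \<open>u\<close> a unit vector and \<open>s = 2 (m \<cdot> u) + d\<close>. When
  \<open>x \<cdot> x \<noteq> 0\<close>, the equation says that \<open>s = (x \<cdot> x - 2 (m \<cdot> x)) / d\<close> is a square root of \<open>x \<cdot> x\<close>, and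
  then \<open>u = x / s\<close>. When \<open>x \<cdot> x = 0\<close>, the equation forces \<open>m \<cdot> x = 0\<close> and so \<open>x = 0\<close>; this point, the
  focus, is reached at a root of \<open>limacon_radius\<close>.
\<close>

lemma limacon_subset_image:
  fixes A m :: "'k::{alg_closed_field, field_char_0} \<times> 'k"
  assumes i: "i * i = (- 1 :: 'k)" and m: "normsq m \<noteq> 0" and d: "d \<noteq> 0"
  shows "limacon A m d \<subseteq> limacon_image i A m d"
proof
  fix P assume "P \<in> limacon A m d"
  moreover define x where "x = P - A"
  ultimately have
    eq: "(normsq x - 2 * (fst m * fst x + snd m * snd x))\<^sup>2 = d\<^sup>2 * normsq x"
    unfolding limacon_def by (simp add: Let_def)
  have P: "P = A + x" by (simp add: x_def)
  define mx where "mx = fst m * fst x + snd m * snd x"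
  show "P \<in> limacon_image i A m d"
  proof (cases "normsq x = 0")
    case False
    define s where "s = (normsq x - 2 * mx) / d"
    have s2: "s\<^sup>2 = normsq x"
      using eq d by (simp add: s_def mx_def power_divide)
    then have s: "s \<noteq> 0" using False by auto
    define u where "u = (fst x / s, snd x / s)"
    have "normsq u = normsq x / s\<^sup>2"
      by (simp add: u_def normsq_def power_divide add_divide_distrib)
    then have "normsq u = 1" using s2 False by simp
    then obtain t where t: "t \<noteq> 0" "unit_vec i t = u" using unit_vec_surj[OF i] by blast
    have ds: "d * s = s * s - 2 * mx" using d s2 by (simp add: s_def power2_eq_square)
    have "2 * (fst m * fst u + snd m * snd u) + d = (2 * mx + d * s) / s"
      using s by (simp add: u_def mx_def field_simps)
    also have "\<dots> = s" using ds s by simp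
    finally have "s = 2 * (fst m * fst u + snd m * snd u) + d" by simp
    from limacon_point_eq[OF i t(1) t(2)[symmetric] this, of A]
    have "limacon_point i A m d t = P"
      using s by (simp add: P u_def)
    then show ?thesis unfolding limacon_image_eq using t(1) by blast
  next
    case True
    then have "mx = 0" using eq unfolding mx_def[symmetric] by simp
    then have mx: "fst m * fst x + snd m * snd x = 0" by (simp only: mx_def)
    have nx: "fst x * fst x + snd x * snd x = 0"
      using True by (simp add: normsq_def power2_eq_square)
    \<comment> \<open>Lagrange's identity\<close>
    have "(fst m * snd x - snd m * fst x)\<^sup>2 =
        normsq m * (fst x * fst x + snd x * snd x) - (fst m * fst x + snd m * snd x)\<^sup>2"
      by (simp add: normsq_def power2_eq_square algebra_simps)
    then have cross: "fst m * snd x - snd m * fst x = 0" using mx nx by simp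
    have "normsq m * fst x =
        fst m * (fst m * fst x + snd m * snd x) - snd m * (fst m * snd x - snd m * fst x)"
      by (simp add: normsq_def power2_eq_square algebra_simps)
    then have x1: "fst x = 0" unfolding mx cross using m by simp
    have "normsq m * snd x =
        snd m * (fst m * fst x + snd m * snd x) + fst m * (fst m * snd x - snd m * fst x)"
      by (simp add: normsq_def power2_eq_square algebra_simps)
    then have x2: "snd x = 0" unfolding mx cross using m by simp
    have x: "x = 0" using x1 x2 by (simp add: prod_eq_iff)
    note nz = isotropic_coordinates_nonzero[OF i m]
    have "degree (limacon_radius i m d) > 0"
      using nz(2) by (simp add: limacon_radius_def)
    then obtain t where t: "poly (limacon_radius i m d) t = 0"
      using alg_closed_imp_poly_has_root by blast
    then have t0: "t \<noteq> 0" using nz by (auto simp: limacon_radius_def)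
    have "2 * (fst m * fst (unit_vec i t) + snd m * snd (unit_vec i t)) + d = 0"
      using poly_limacon_radius[OF i t0 refl, of m d] t t0 by simp
    from limacon_point_eq[OF i t0 refl this[symmetric], of A]
    have "limacon_point i A m d t = P"
      by (simp add: P x prod_eq_iff)
    then show ?thesis unfolding limacon_image_eq using t0 by blast
  qed
qed

lemma limacon_image_subset:
  fixes A m :: "'k::field_char_0 \<times> 'k"
  assumes i: "i * i = (- 1 :: 'k)"
  shows "limacon_image i A m d \<subseteq> limacon A m d"
proof
  fix P assume "P \<in> limacon_image i A m d"
  then obtain t where t: "t \<noteq> 0" and P: "P = limacon_point i A m d t"
    unfolding limacon_image_eq by blast
  define u where "u = unit_vec i t"
  define mu where "mu = fst m * fst u + snd m * snd u"
  define s where "s = 2 * mu + d"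
  have u: "normsq u = 1" using normsq_unit_vec[OF i t] by (simp add: u_def)
  have P: "P - A = (s * fst u, s * snd u)"
    using limacon_point_eq[OF i t u_def, of s m d A] P by (simp add: s_def mu_def)
  have n: "normsq (P - A) = s\<^sup>2"
    using u unfolding P by (simp add: normsq_def power_mult_distrib flip: distrib_left)
  have mx: "fst m * fst (P - A) + snd m * snd (P - A) = s * mu"
    unfolding P by (simp add: mu_def algebra_simps)
  have "s\<^sup>2 - 2 * (s * mu) = d * s" by (simp add: s_def power2_eq_square algebra_simps)
  then show "P \<in> limacon A m d"
    unfolding limacon_def Let_def mem_Collect_eq n mx by (simp add: power_mult_distrib)
qed

lemma limacon_eq_image:
  fixes A m :: "'k::{alg_closed_field, field_char_0} \<times> 'k"
  assumes "i * i = (- 1 :: 'k)" "normsq m \<noteq> 0" "d \<noteq> 0"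
  shows "limacon A m d = limacon_image i A m d"
  using limacon_subset_image[OF assms] limacon_image_subset[OF assms(1)] by blast

section \<open>The conchoid of a circle from a focus on it\<close>

lemma circle_through_iff:
  assumes "A \<in> circle c r"
  shows "y \<in> circle c r \<longleftrightarrow>
    normsq (y - A) = 2 * (fst (c - A) * fst (y - A) + snd (c - A) * snd (y - A))"
proof -
  have "(fst y - fst c)\<^sup>2 + (snd y - snd c)\<^sup>2 - ((fst A - fst c)\<^sup>2 + (snd A - snd c)\<^sup>2) =
      normsq (y - A) - 2 * (fst (c - A) * fst (y - A) + snd (c - A) * snd (y - A))"
    by (simp add: normsq_def power2_eq_square algebra_simps)
  moreover have "(fst A - fst c)\<^sup>2 + (snd A - snd c)\<^sup>2 = r\<^sup>2"
    using assms by (simp add: circle_def)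
  ultimately show ?thesis unfolding circle_def mem_Collect_eq
    by (metis eq_iff_diff_eq_0)
qed

text \<open>
  The conchoid before taking the Zariski closure; its distance and collinearity conditions can be
  checked point by point.
\<close>

definition conchoid_points ::
    "('k::comm_ring_1 \<times> 'k) set \<Rightarrow> 'k \<times> 'k \<Rightarrow> 'k \<Rightarrow> ('k \<times> 'k) set" where
  "conchoid_points C A d =
     {x. \<exists>y\<in>C. \<exists>l. normsq (x - y) = d\<^sup>2 \<and> x = A + (l * fst (y - A), l * snd (y - A))}"

text \<open>
  With \<open>w = y - A\<close> and \<open>n = w \<cdot> w = 2 (m \<cdot> w)\<close>, the two sides of the quartic at \<open>l w\<close> are
  \<open>(l\<^sup>2 n - l n)\<^sup>2\<close> and \<open>d\<^sup>2 l\<^sup>2 n\<close>, and they agree because \<open>d\<^sup>2 = (l - 1)\<^sup>2 n\<close>.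
\<close>

lemma conchoid_points_subset_limacon:
  fixes A c :: "'k::field \<times> 'k"
  assumes A: "A \<in> circle c r"
  shows "conchoid_points (circle c r) A d \<subseteq> limacon A (c - A) d"
proof
  fix x assume "x \<in> conchoid_points (circle c r) A d"
  then obtain y l where y: "y \<in> circle c r" and dist: "normsq (x - y) = d\<^sup>2"
    and x: "x = A + (l * fst (y - A), l * snd (y - A))"
    unfolding conchoid_points_def by blast
  define w where "w = y - A"
  define n where "n = normsq w"
  have y_eq: "y = A + w" by (simp add: w_def)
  have mw: "2 * (fst (c - A) * fst w + snd (c - A) * snd w) = n"
    using circle_through_iff[OF A] y unfolding w_def n_def by simp
  have d: "d\<^sup>2 = (l - 1)\<^sup>2 * n"
    unfolding dist[symmetric] x w_def[symmetric] n_def unfolding y_eq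
    by (simp add: normsq_def power2_eq_square algebra_simps)
  have xA: "x - A = (l * fst w, l * snd w)" by (simp add: x w_def)
  have n1: "normsq (x - A) = l\<^sup>2 * n"
    unfolding xA n_def by (simp add: normsq_def power_mult_distrib distrib_left)
  have mx: "2 * (fst (c - A) * fst (x - A) + snd (c - A) * snd (x - A)) = l * n"
    unfolding xA mw[symmetric] by (simp add: algebra_simps)
  have "(l\<^sup>2 * n - l * n)\<^sup>2 = d\<^sup>2 * (l\<^sup>2 * n)"
    unfolding d by (simp add: power2_eq_square algebra_simps)
  then show "x \<in> limacon A (c - A) d"
    unfolding limacon_def Let_def mem_Collect_eq n1 mx .
qed

text \<open>
  The point lies at distance \<open>d\<close> from the second intersection \<open>y = A + 2 (m \<cdot> u) u\<close> of the circle with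
  the line through \<open>A\<close> in direction \<open>u\<close>. When \<open>m \<cdot> u = 0\<close>, this \<open>y\<close> is the focus itself, which no
  longer determines a line.
\<close>

lemma limacon_point_in_conchoid_points:
  fixes A c :: "'k::field_char_0 \<times> 'k"
  assumes A: "A \<in> circle c r" and i: "i * i = (- 1 :: 'k)" and t: "t \<noteq> 0"
    and u: "u = unit_vec i t" and mu: "fst (c - A) * fst u + snd (c - A) * snd u \<noteq> 0"
  shows "limacon_point i A (c - A) d t \<in> conchoid_points (circle c r) A d"
proof -
  define q where "q = 2 * (fst (c - A) * fst u + snd (c - A) * snd u)"
  have q: "q \<noteq> 0" using mu unfolding q_def by (simp only: mult_eq_0_iff) simp
  have n: "fst u * fst u + snd u * snd u = 1"
    using normsq_unit_vec[OF i t] by (simp add: u normsq_def power2_eq_square)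
  define y where "y = A + (q * fst u, q * snd u)"
  have yA: "y - A = (q * fst u, q * snd u)" by (simp add: y_def)
  have P: "limacon_point i A (c - A) d t = A + ((q + d) * fst u, (q + d) * snd u)"
    using limacon_point_eq[OF i t u, of "q + d"] by (simp add: q_def)
  have "normsq (y - A) = q * q * (fst u * fst u + snd u * snd u)"
    unfolding yA by (simp add: normsq_def power2_eq_square algebra_simps)
  also have "\<dots> = q * q" using n by simp
  also have "\<dots> = 2 * (fst (c - A) * fst (y - A) + snd (c - A) * snd (y - A))"
    unfolding yA by (subst (2) q_def) (simp add: algebra_simps)
  finally have y: "y \<in> circle c r" using circle_through_iff[OF A] by blast
  have "normsq (limacon_point i A (c - A) d t - y) = d\<^sup>2 * (fst u * fst u + snd u * snd u)"
    unfolding P y_def by (simp add: normsq_def power2_eq_square algebra_simps)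
  then have dist: "normsq (limacon_point i A (c - A) d t - y) = d\<^sup>2" using n by simp
  have l: "limacon_point i A (c - A) d t =
      A + ((q + d) / q * fst (y - A), (q + d) / q * snd (y - A))"
    unfolding P yA using q by simp
  show ?thesis
    unfolding conchoid_points_def using y dist l by blast
qed

text \<open>
  The defining set of the conchoid misses at most the parameters where \<open>m \<cdot> u = 0\<close>; since
  \<open>2 t (m \<cdot> u)\<close> is the polynomial \<open>limacon_radius\<close> with \<open>d = 0\<close>, these are finitely many. The
  quartic is closed and contains the defining set, and every closed set containing it contains the
  whole parametrized curve, so the closure is that curve.
\<close>

lemma conchoid_circle_eq_limacon_image:
  fixes A c :: "'k::{alg_closed_field, field_char_0} \<times> 'k"
  assumes A: "A \<in> circle c r" and i: "i * i = (- 1 :: 'k)"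
    and m: "normsq (c - A) \<noteq> 0" and d: "d \<noteq> 0"
  shows "conchoid (circle c r) A d = limacon_image i A (c - A) d"
proof -
  let ?m = "c - A"
  let ?S = "conchoid_points (circle c r) A d"
  have conchoid: "conchoid (circle c r) A d = \<Inter> {X. zariski_closed X \<and> ?S \<subseteq> X}"
    by (simp add: conchoid_def conchoid_points_def zariski_closure_def)
  have image: "limacon_image i A ?m d = limacon A ?m d"
    using limacon_eq_image[OF i m d] by simp
  have "zariski_closed (limacon A ?m d)"
  proof -
    obtain f where "limacon A ?m d = {P. poly2 f P = 0}"
      using plane_curve_limacon[OF i m] unfolding plane_curve_def by blast
    then show ?thesis unfolding zariski_closed_def by (intro exI[of _ "{f}"]) simp
  qed
  then have le: "conchoid (circle c r) A d \<subseteq> limacon_image i A ?m d"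
    unfolding conchoid image using conchoid_points_subset_limacon[OF A] by blast
  have "limacon_image i A ?m d \<subseteq> X" if X: "zariski_closed X" "?S \<subseteq> X" for X
    unfolding limacon_image_def
  proof (rule zariski_closed_contains_param_curve[OF X(1)])
    let ?h = "[:0, 1:] * limacon_radius i ?m 0"
    have "limacon_radius i ?m 0 \<noteq> 0"
      unfolding limacon_radius_def pCons_eq_0_iff
      using isotropic_coordinates_nonzero(1)[OF i m] by blast
    then have "?h \<noteq> 0" by (simp del: mult_pCons_left)
    then have "infinite {t. poly ?h t \<noteq> 0}" by (rule infinite_nonroots)
    moreover have "{t. poly ?h t \<noteq> 0} \<subseteq> {t. poly limacon_den t \<noteq> 0 \<and>
        param_point (limacon_num1 i A ?m d) (limacon_num2 i A ?m d) limacon_den t \<in> X}"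
    proof
      fix t assume "t \<in> {t. poly ?h t \<noteq> 0}"
      then have t: "t \<noteq> 0" and "poly (limacon_radius i ?m 0) t \<noteq> 0"
        by (auto simp del: mult_pCons_left)
      then have "fst ?m * fst (unit_vec i t) + snd ?m * snd (unit_vec i t) \<noteq> 0"
        using poly_limacon_radius[OF i t refl, of ?m 0] by (metis add_0_right mult_zero_right)
      then show "t \<in> {t. poly limacon_den t \<noteq> 0 \<and>
          param_point (limacon_num1 i A ?m d) (limacon_num2 i A ?m d) limacon_den t \<in> X}"
        using limacon_point_in_conchoid_points[OF A i t refl, of d] X(2) t
        unfolding limacon_point_def by auto
    qed
    ultimately show "infinite {t. poly limacon_den t \<noteq> 0 \<and>
        param_point (limacon_num1 i A ?m d) (limacon_num2 i A ?m d) limacon_den t \<in> X}"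
      using finite_subset by blast
  qed
  then show ?thesis using le unfolding conchoid by blast
qed

theorem corollary3p16:
  fixes c A :: "'k::{alg_closed_field, field_char_0} \<times> 'k" and r d :: 'k
  assumes "r \<noteq> 0"
    and "A \<in> circle c r"
    and "d \<noteq> 0"
  shows "rational_plane_curve (conchoid (circle c r) A d)"
proof -
  let ?m = "c - A"
  obtain i :: 'k where "i\<^sup>2 = - 1"
    using nth_root_exists[of 2 "- 1 :: 'k"] by auto
  then have i: "i * i = - 1" by (simp add: power2_eq_square)
  have "normsq ?m = r\<^sup>2"
    using assms(2) by (simp add: circle_def normsq_def power2_commute)
  then have m: "normsq ?m \<noteq> 0" using assms(1) by simp
  note b = isotropic_coordinates_nonzero(1)[OF i m]
  have i0: "i \<noteq> 0" using i by auto
  have "rational_plane_curve (limacon_image i A ?m d)"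
    unfolding limacon_image_def
  proof (rule rational_plane_curve_param_curve[of _ 0])
    show "(limacon_den :: 'k poly) \<noteq> 0" by (simp add: limacon_den_def)
    show "poly limacon_den (0 :: 'k) = 0" by simp
    \<comment> \<open>At \<open>t = 0\<close>, the only pole, both numerators are nonzero multiples of \<open>m\<^sub>1 + i m\<^sub>2\<close>.\<close>
    have r: "poly (limacon_radius i ?m d) 0 \<noteq> 0"
      using b unfolding limacon_radius_def by simp
    show "poly (limacon_num1 i A ?m d) s \<noteq> 0" if "poly limacon_den s = 0" for s
      using that r by (simp add: limacon_num1_def limacon_den_def)
    show "poly (limacon_num2 i A ?m d) s \<noteq> 0" if "poly limacon_den s = 0" for s
      using that r i0 by (simp add: limacon_num2_def limacon_den_def)
    show "plane_curve (param_curve (limacon_num1 i A ?m d) (limacon_num2 i A ?m d) limacon_den)"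
      using plane_curve_limacon[OF i m] limacon_eq_image[OF i m assms(3)]
      unfolding limacon_image_def by metis
  qed
  then show ?thesis
    using conchoid_circle_eq_limacon_image[OF assms(2) i m assms(3)] by simp
qed

end
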